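(* The protocol described in the context satisfies, at the BCRB layer: (Validity / Liveness) if a correct process BCRB-broadcasts $m$, all correct processes eventually BCRB-deliver $m$; (Agreement) if a correct process BCRB-delivers $m$, all correct processes eventually BCRB-deliver $m$; (Integrity) a message $m$ is BCRB-delivered at most once by each correct process and, if its sender is correct, only if it was broadcast by the sender.
   Context: System: asynchronous, $n$ processes, at most $f$ Byzantine (arbitrary, possibly colluding), $n\ge3f+1$; reliable authenticated point-to-point FIFO channels. A Byzantine Reliable Broadcast (BRB) primitive brb_broadcast/brb_deliver satisfies Validity, Agreement and Integrity (the same three properties as in the claim, with BRB in place of BCRB). There is a randomized $(n-f,n)$ threshold encryption scheme (public key $PK$, key shares $SK_i$; $n-f$ valid decryption shares from distinct processes decrypt) and a cryptographic hash function; ciphertexts are unpredictable, so the hash of a ciphertext cannot be computed before it has been broadcast. Protocol with BRB of ACKs (process $p_i$). State: $local\_sn=0$; vector $V_i=[0,\dots,0]$; set $pending=\emptyset$; share sets $shares[\cdot]=\emptyset$; directed graph $G=(N,E)$ of message IDs, initially empty. - bcrb_broadcast(payload): $local\_sn\leftarrow local\_sn+1$; encrypt the payload under $PK$; brb_broadcast$(i,local\_sn,ciphertext)$. - Upon brb_deliver$(j,sn,payload)$: wait until all $(j,s)$ with $s<sn$ are BRB-delivered and their brb_deliver processing is completed. If $payload$ is an ACK $[M=(k,sn^k),share,h]$: wait until all $(k,s')$ with $s'\le sn^k$ are BRB-delivered and processed; if $M\in N$ and $h=hash(M.ciphertext)$, add $share$ to $shares[M]$ and add the edge $((j,sn+1)^{temp},(k,sn^k))$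 to $E$ (a temporary node). Otherwise: $local\_sn\leftarrow local\_sn+1$; compute the decryption share of $payload$ with $SK_i$ and $h=hash(payload)$; brb_broadcast$(i,local\_sn,ACK[(j,sn),share,h])$. In both cases then: if $(j,sn)^{temp}$ exists relabel it $(j,sn)$, else add $(j,sn)$ to $N$; if $(j,sn-1)\in N$ add the edge $((j,sn),(j,sn-1))$; add $((j,sn),payload)$ to $pending$; run check_delivery. - check_delivery: repeatedly, for any $((j,sn),payload)\in pending$ with $V_i[j]=sn-1$, with $|shares[(j,sn)]|\ge n-f$ if $payload$ is not an ACK, and with no outgoing edge from $(j,sn)$ in $E$: remove it from $pending$, delete its node and incident edges from $G$, set $V_i[j]\leftarrow sn$, and, if $payload$ is not an ACK, decrypt and BCRB-deliver the plaintext (bcrb_deliver).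
   Formalization: The delivery test counts distinct processes that sent a valid share rather than |shares|; threshold decryption of ciphertexts not made by encryption is assumed independent of the shares used; BRB "at most once" is per (sender, sequence number). *)

theory Defs
  imports Main
begin

subsection \<open>Reliable broadcast\<close>

text \<open>
  A message is identified by its sender and its sequence number and has a content.
  A run is observed at discrete times: \<open>bc t (i, sn) x\<close> says that at time \<open>t\<close> process \<open>i\<close>
  broadcasts the message \<open>(i, sn)\<close> with content \<open>x\<close>; \<open>dl t k (j, sn) x\<close> says that at time
  \<open>t\<close> process \<open>k\<close> delivers it. The same three properties serve for BRB (as assumptions,
  content = wire payload) and for BCRB (as conclusions, content = plaintext).
  "At most once" is per identifier, so that a Byzantine sender cannot have two contents
  delivered under one identifier.
\<close>

type_synonym 'p mid = "'p \<times> nat"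

definition rb_validity ::
    "'p set \<Rightarrow> (nat \<Rightarrow> 'p mid \<Rightarrow> 'x \<Rightarrow> bool) \<Rightarrow> (nat \<Rightarrow> 'p \<Rightarrow> 'p mid \<Rightarrow> 'x \<Rightarrow> bool) \<Rightarrow> bool" where
  "rb_validity Corr bc dl \<longleftrightarrow>
     (\<forall>t sn x. \<forall>i\<in>Corr. bc t (i, sn) x \<longrightarrow> (\<forall>k\<in>Corr. \<exists>t'\<ge>t. dl t' k (i, sn) x))"

definition rb_agreement ::
    "'p set \<Rightarrow> (nat \<Rightarrow> 'p \<Rightarrow> 'p mid \<Rightarrow> 'x \<Rightarrow> bool) \<Rightarrow> bool" where
  "rb_agreement Corr dl \<longleftrightarrow>
     (\<forall>t M x. \<forall>i\<in>Corr. dl t i M x \<longrightarrow> (\<forall>k\<in>Corr. \<exists>t'. dl t' k M x))"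

definition rb_integrity ::
    "'p set \<Rightarrow> (nat \<Rightarrow> 'p mid \<Rightarrow> 'x \<Rightarrow> bool) \<Rightarrow> (nat \<Rightarrow> 'p \<Rightarrow> 'p mid \<Rightarrow> 'x \<Rightarrow> bool) \<Rightarrow> bool" where
  "rb_integrity Corr bc dl \<longleftrightarrow>
     (\<forall>k\<in>Corr. \<forall>M t x t' x'. dl t k M x \<and> dl t' k M x' \<longrightarrow> t = t' \<and> x = x') \<and>
     (\<forall>k\<in>Corr. \<forall>j\<in>Corr. \<forall>sn t x. dl t k (j, sn) x \<longrightarrow> (\<exists>t0<t. bc t0 (j, sn) x))"


subsection \<open>Cryptographic primitives\<close>

text \<open>
  \<open>encrypt pk m r\<close> is the encryption of \<open>m\<close> with random coins \<open>r\<close>.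
  \<open>valid_share c k sh\<close> says that \<open>sh\<close> is a valid decryption share of process \<open>k\<close> for \<open>c\<close>.
\<close>

record ('p, 'pk, 'sk, 'm, 'r, 'c, 'sh, 'h) crypto =
  pub_key :: 'pk
  key_share :: "'p \<Rightarrow> 'sk"
  encrypt :: "'pk \<Rightarrow> 'm \<Rightarrow> 'r \<Rightarrow> 'c"
  dec_share :: "'sk \<Rightarrow> 'c \<Rightarrow> 'sh"
  valid_share :: "'c \<Rightarrow> 'p \<Rightarrow> 'sh \<Rightarrow> bool"
  combine :: "'c \<Rightarrow> ('p \<times> 'sh) set \<Rightarrow> 'm"
  hash :: "'c \<Rightarrow> 'h"

definition enough_shares ::
    "('p, 'pk, 'sk, 'm, 'r, 'c, 'sh, 'h) crypto \<Rightarrow> nat \<Rightarrow> 'c \<Rightarrow> ('p \<times> 'sh) set \<Rightarrow> bool" where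
  "enough_shares C thr c S \<longleftrightarrow>
     finite S \<and> (\<forall>(k, sh) \<in> S. valid_share C c k sh) \<and> thr \<le> card (fst ` S)"

text \<open>
  The third clause concerns ciphertexts that need not be outputs of \<open>encrypt\<close> (those chosen
  by Byzantine processes): the result of decryption does not depend on which shares are used.
\<close>

definition threshold_encryption ::
    "('p, 'pk, 'sk, 'm, 'r, 'c, 'sh, 'h) crypto \<Rightarrow> nat \<Rightarrow> bool" where
  "threshold_encryption C thr \<longleftrightarrow>
     (\<forall>i c. valid_share C c i (dec_share C (key_share C i) c)) \<and>
     (\<forall>m r S. let c = encrypt C (pub_key C) m r in
        enough_shares C thr c S \<longrightarrow> combine C c S = m) \<and>
     (\<forall>c S S'. enough_shares C thr c S \<and> enough_shares C thr c S' \<longrightarrow>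
        combine C c S = combine C c S')"


subsection \<open>Local states of a correct process\<close>

datatype ('p, 'c, 'sh, 'h) payload = Cipher 'c | Ack "'p mid" 'sh 'h

datatype 'p node = Node "'p mid" | Temp "'p mid"

text \<open>
  A \<open>brb_deliver\<close> puts the message into \<open>received\<close>; its identifier enters
  \<open>processed\<close> when the handler, having passed its waits, is executed. The sets \<open>shares\<close> record
  the process that sent the share.
\<close>

record ('p, 'c, 'sh, 'h) pstate =
  local_sn :: nat
  vec :: "'p \<Rightarrow> nat"
  pending :: "('p mid \<times> ('p, 'c, 'sh, 'h) payload) set"
  shares :: "'p mid \<Rightarrow> ('p \<times> 'sh) set"
  nodes :: "'p node set"
  edges :: "('p node \<times> 'p node) set"
  received :: "('p mid \<times> ('p, 'c, 'sh, 'h) payload) set"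
  processed :: "'p mid set"

definition init_state :: "('p, 'c, 'sh, 'h) pstate" where
  "init_state = \<lparr>local_sn = 0, vec = (\<lambda>_. 0), pending = {}, shares = (\<lambda>_. {}),
     nodes = {}, edges = {}, received = {}, processed = {}\<rparr>"

text \<open>
  The waits of the \<open>brb_deliver\<close> handler. Sequence numbers start at \<open>1\<close>; a message numbered
  \<open>0\<close> is malformed and never handled. Wait conditions, once true, stay true, so the two
  consecutive waits of the ACK case are a single conjunction.
\<close>

definition ready ::
    "('p, 'c, 'sh, 'h) pstate \<Rightarrow> 'p mid \<Rightarrow> ('p, 'c, 'sh, 'h) payload \<Rightarrow> bool" where
  "ready s = (\<lambda>(j, sn) p.
     1 \<le> sn \<and> ((j, sn), p) \<in> received s \<and> (j, sn) \<notin> processed s \<and>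
     (\<forall>s'\<in>{1..<sn}. (j, s') \<in> processed s) \<and>
     (case p of Cipher c \<Rightarrow> True
      | Ack M sh h \<Rightarrow> (\<forall>s'\<in>{1..snd M}. (fst M, s') \<in> processed s)))"

text \<open>
  If the acknowledged message \<open>M\<close> is itself an ACK, it has no ciphertext and the hash test fails.
\<close>

definition on_ack ::
    "('p, 'pk, 'sk, 'm, 'r, 'c, 'sh, 'h) crypto \<Rightarrow> 'p mid \<Rightarrow> 'p mid \<Rightarrow> 'sh \<Rightarrow> 'h \<Rightarrow>
     ('p, 'c, 'sh, 'h) pstate \<Rightarrow> ('p, 'c, 'sh, 'h) pstate" where
  "on_ack C = (\<lambda>(j, sn) M sh h s.
     if Node M \<in> nodes s \<and> (\<exists>c. (M, Cipher c) \<in> received s \<and> h = hash C c)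
     then s\<lparr>shares := (shares s)(M := insert (j, sh) (shares s M)),
            nodes := insert (Temp (j, sn + 1)) (nodes s),
            edges := insert (Temp (j, sn + 1), Node M) (edges s)\<rparr>
     else s)"

definition relabel :: "'p mid \<Rightarrow> 'p node \<Rightarrow> 'p node" where
  "relabel M v = (if v = Temp M then Node M else v)"

definition add_node ::
    "'p mid \<Rightarrow> ('p, 'c, 'sh, 'h) pstate \<Rightarrow> ('p, 'c, 'sh, 'h) pstate" where
  "add_node M s =
     (if Temp M \<in> nodes s
      then s\<lparr>nodes := relabel M ` nodes s,
             edges := map_prod (relabel M) (relabel M) ` edges s\<rparr>
      else s\<lparr>nodes := insert (Node M) (nodes s)\<rparr>)"

definition add_pred_edge ::
    "'p mid \<Rightarrow> ('p, 'c, 'sh, 'h) pstate \<Rightarrow> ('p, 'c, 'sh, 'h) pstate" where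
  "add_pred_edge = (\<lambda>(j, sn) s.
     if Node (j, sn - 1) \<in> nodes s
     then s\<lparr>edges := insert (Node (j, sn), Node (j, sn - 1)) (edges s)\<rparr> else s)"

definition enqueue ::
    "'p mid \<Rightarrow> ('p, 'c, 'sh, 'h) payload \<Rightarrow>
     ('p, 'c, 'sh, 'h) pstate \<Rightarrow> ('p, 'c, 'sh, 'h) pstate" where
  "enqueue M p s =
     (let s' = add_pred_edge M (add_node M s)
      in s'\<lparr>pending := insert (M, p) (pending s'), processed := insert M (processed s')\<rparr>)"

text \<open>
  The number of shares is the number of distinct processes that sent a valid one: invalid
  shares and repeated shares of one (Byzantine) process do not help to decrypt.
\<close>

definition valid_shares ::
    "('p, 'pk, 'sk, 'm, 'r, 'c, 'sh, 'h) crypto \<Rightarrow> ('p, 'c, 'sh, 'h) pstate \<Rightarrow>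
     'p mid \<Rightarrow> 'c \<Rightarrow> ('p \<times> 'sh) set" where
  "valid_shares C s M c = {(k, sh) \<in> shares s M. valid_share C c k sh}"

definition deliverable ::
    "('p, 'pk, 'sk, 'm, 'r, 'c, 'sh, 'h) crypto \<Rightarrow> nat \<Rightarrow> ('p, 'c, 'sh, 'h) pstate \<Rightarrow>
     'p mid \<Rightarrow> ('p, 'c, 'sh, 'h) payload \<Rightarrow> bool" where
  "deliverable C thr s = (\<lambda>(j, sn) p.
     ((j, sn), p) \<in> pending s \<and> vec s j + 1 = sn \<and>
     (case p of Cipher c \<Rightarrow> thr \<le> card (fst ` valid_shares C s (j, sn) c)
      | Ack M sh h \<Rightarrow> True) \<and>
     (\<forall>v. (Node (j, sn), v) \<notin> edges s))"

definition remove_msg ::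
    "'p mid \<Rightarrow> ('p, 'c, 'sh, 'h) payload \<Rightarrow>
     ('p, 'c, 'sh, 'h) pstate \<Rightarrow> ('p, 'c, 'sh, 'h) pstate" where
  "remove_msg M p s = s\<lparr>pending := pending s - {(M, p)},
     nodes := nodes s - {Node M},
     edges := {(u, v) \<in> edges s. u \<noteq> Node M \<and> v \<noteq> Node M},
     vec := (vec s)(fst M := snd M)\<rparr>"


subsection \<open>Steps of a correct process\<close>

text \<open>
  \<^item> \<open>Bcrb_Broadcast sn m c\<close>: \<open>bcrb_broadcast(m)\<close>, which numbers the message \<open>sn\<close> and
    BRB-broadcasts the ciphertext \<open>c\<close>.
  \<^item> \<open>Brb_Deliver M p\<close>: \<open>brb_deliver\<close> is called.
  \<^item> \<open>Handle M p out\<close>: the \<open>brb_deliver\<close> handler of \<open>M\<close> is executed up to the call of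
    \<open>check_delivery\<close>; \<open>out\<close> is the ACK that is BRB-broadcast (with its number), if any.
  \<^item> \<open>Deliver M out\<close>: one iteration of the loop of \<open>check_delivery\<close>, removing \<open>M\<close>;
    \<open>out\<close> is the plaintext that is BCRB-delivered, if any.
\<close>

datatype ('p, 'm, 'c, 'sh, 'h) action =
    Bcrb_Broadcast nat 'm 'c
  | Brb_Deliver "'p mid" "('p, 'c, 'sh, 'h) payload"
  | Handle "'p mid" "('p, 'c, 'sh, 'h) payload" "(nat \<times> ('p, 'c, 'sh, 'h) payload) option"
  | Deliver "'p mid" "'m option"
  | Idle

text \<open>
  No handler starts while a message is deliverable. Only \<open>Handle\<close> steps make messages
  deliverable, so this says that \<open>check_delivery\<close>, called at the end of each handler, runs until
  no message qualifies before the next handler is executed.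
\<close>

inductive step ::
    "('p, 'pk, 'sk, 'm, 'r, 'c, 'sh, 'h) crypto \<Rightarrow> nat \<Rightarrow> 'p \<Rightarrow> ('p, 'c, 'sh, 'h) pstate \<Rightarrow>
     ('p, 'm, 'c, 'sh, 'h) action \<Rightarrow> ('p, 'c, 'sh, 'h) pstate \<Rightarrow> bool"
  for C thr i s where
  bcrb_broadcast:
    "sn = local_sn s + 1 \<Longrightarrow> c = encrypt C (pub_key C) m r \<Longrightarrow>
     step C thr i s (Bcrb_Broadcast sn m c) (s\<lparr>local_sn := sn\<rparr>)"
| brb_deliver:
    "step C thr i s (Brb_Deliver M p) (s\<lparr>received := insert (M, p) (received s)\<rparr>)"
| handle_ack:
    "\<not> (\<exists>M' p'. deliverable C thr s M' p') \<Longrightarrow> ready s M (Ack K sh h) \<Longrightarrow>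
     step C thr i s (Handle M (Ack K sh h) None)
       (enqueue M (Ack K sh h) (on_ack C M K sh h s))"
| handle_cipher:
    "\<not> (\<exists>M' p'. deliverable C thr s M' p') \<Longrightarrow> ready s M (Cipher c) \<Longrightarrow>
     sn = local_sn s + 1 \<Longrightarrow>
     step C thr i s
       (Handle M (Cipher c) (Some (sn, Ack M (dec_share C (key_share C i) c) (hash C c))))
       (enqueue M (Cipher c) (s\<lparr>local_sn := sn\<rparr>))"
| deliver_ack:
    "deliverable C thr s M (Ack K sh h) \<Longrightarrow>
     step C thr i s (Deliver M None) (remove_msg M (Ack K sh h) s)"
| deliver_cipher:
    "deliverable C thr s M (Cipher c) \<Longrightarrow>
     step C thr i s (Deliver M (Some (combine C c (valid_shares C s M c))))
       (remove_msg M (Cipher c) s)"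
| idle:
    "step C thr i s Idle s"


subsection \<open>Executions\<close>

text \<open>
  At time \<open>t\<close> process \<open>fst (ev t)\<close> performs \<open>snd (ev t)\<close>, and \<open>st t i\<close> is the local state of \<open>i\<close>
  before that. States and actions of Byzantine processes are unconstrained; they influence correct
  processes only through what BRB delivers.
\<close>

type_synonym ('p, 'm, 'c, 'sh, 'h) trace = "nat \<Rightarrow> 'p \<times> ('p, 'm, 'c, 'sh, 'h) action"

definition execution ::
    "('p, 'pk, 'sk, 'm, 'r, 'c, 'sh, 'h) crypto \<Rightarrow> nat \<Rightarrow> 'p set \<Rightarrow>
     ('p, 'm, 'c, 'sh, 'h) trace \<Rightarrow> (nat \<Rightarrow> 'p \<Rightarrow> ('p, 'c, 'sh, 'h) pstate) \<Rightarrow> bool" where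
  "execution C thr Corr ev st \<longleftrightarrow>
     (\<forall>i\<in>Corr. st 0 i = init_state) \<and>
     (\<forall>t. \<forall>i\<in>Corr. if i = fst (ev t) then step C thr i (st t i) (snd (ev t)) (st (Suc t) i)
                   else st (Suc t) i = st t i)"

text \<open>
  Correct processes do not stop: a handler whose waits are over is eventually executed, and
  \<open>check_delivery\<close> eventually takes each message that qualifies. There is no bound on the delay.
\<close>

definition fair ::
    "('p, 'pk, 'sk, 'm, 'r, 'c, 'sh, 'h) crypto \<Rightarrow> nat \<Rightarrow> 'p set \<Rightarrow>
     ('p, 'm, 'c, 'sh, 'h) trace \<Rightarrow> (nat \<Rightarrow> 'p \<Rightarrow> ('p, 'c, 'sh, 'h) pstate) \<Rightarrow> bool" where
  "fair C thr Corr ev st \<longleftrightarrow>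
     (\<forall>t M p. \<forall>i\<in>Corr.
        (ready (st t i) M p \<longrightarrow> (\<exists>t'\<ge>t. \<exists>out. ev t' = (i, Handle M p out))) \<and>
        (deliverable C thr (st t i) M p \<longrightarrow> (\<exists>t'\<ge>t. \<exists>out. ev t' = (i, Deliver M out))))"

definition brb_bc ::
    "('p, 'm, 'c, 'sh, 'h) trace \<Rightarrow> nat \<Rightarrow> 'p mid \<Rightarrow> ('p, 'c, 'sh, 'h) payload \<Rightarrow> bool" where
  "brb_bc ev t = (\<lambda>(i, sn) p.
     (\<exists>m c. ev t = (i, Bcrb_Broadcast sn m c) \<and> p = Cipher c) \<or>
     (\<exists>M q. ev t = (i, Handle M q (Some (sn, p)))))"

definition brb_dl ::
    "('p, 'm, 'c, 'sh, 'h) trace \<Rightarrow> nat \<Rightarrow> 'p \<Rightarrow> 'p mid \<Rightarrow> ('p, 'c, 'sh, 'h) payload \<Rightarrow> bool" where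
  "brb_dl ev t k M p \<longleftrightarrow> ev t = (k, Brb_Deliver M p)"

definition bcrb_bc ::
    "('p, 'm, 'c, 'sh, 'h) trace \<Rightarrow> nat \<Rightarrow> 'p mid \<Rightarrow> 'm \<Rightarrow> bool" where
  "bcrb_bc ev t = (\<lambda>(i, sn) m. \<exists>c. ev t = (i, Bcrb_Broadcast sn m c))"

definition bcrb_dl ::
    "('p, 'm, 'c, 'sh, 'h) trace \<Rightarrow> nat \<Rightarrow> 'p \<Rightarrow> 'p mid \<Rightarrow> 'm \<Rightarrow> bool" where
  "bcrb_dl ev t k M m \<longleftrightarrow> ev t = (k, Deliver M (Some m))"

text \<open>
  Unpredictability of the ciphertexts of correct processes, as visible in a trace: an
  acknowledgement with the right hash is not seen before the ciphertext has been broadcast.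
\<close>

definition unpredictable ::
    "('p, 'pk, 'sk, 'm, 'r, 'c, 'sh, 'h) crypto \<Rightarrow> 'p set \<Rightarrow>
     ('p, 'm, 'c, 'sh, 'h) trace \<Rightarrow> bool" where
  "unpredictable C Corr ev \<longleftrightarrow>
     (\<forall>t0 sn c t M sh. \<forall>i\<in>Corr. \<forall>k\<in>Corr.
        brb_bc ev t0 (i, sn) (Cipher c) \<and> brb_dl ev t k M (Ack (i, sn) sh (hash C c)) \<longrightarrow> t0 < t)"

end

(*
  At a correct process, the target of every edge is a message that was handled before the source
  of the edge and has not been removed yet. Hence the graph never blocks for good: by induction on
  time, everything handled up to time t is removed eventually. The shares that a ciphertext needs
  arrive because every correct process handles the same messages, and acknowledges each ciphertext.
*)
theory Submission
  imports Defs
begin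

text \<open>The obstacle is that an ACK of \<open>j\<close> creates an edge for the next message of
  \<open>j\<close>, which has not been handled yet and, if \<open>j\<close> is Byzantine, may never
  be. Such an edge starts at a \<open>Temp\<close> node and blocks nothing until that node is
  relabelled. Deliverability looks only at edges out of \<open>Node M\<close>, and these arise only
  while \<open>M\<close> is being handled. Afterwards the set of blockers of \<open>M\<close> can
  only shrink, however many ACKs Byzantine processes send, so waiting for messages handled earlier
  is enough. The handled messages agree for a similar reason: the waits of a handler depend only on
  the BRB payload, which is common to all correct processes, and concern messages handled earlier.
  Shares are subject to a race: a process may remove \<open>M\<close> before some ACK for it is
  handled, and then the share is discarded. Statements about shares therefore carry the alternative
  that \<open>M\<close> has already been removed, which the final progress argument excludes by
  contradiction. At least \<open>n - f\<close> processes are correct, so they reach the threshold on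
  their own.\<close>

declare split_paired_All [simp del] split_paired_Ex [simp del]

section \<open>Local steps\<close>

lemma enqueue_simps [simp]:
  "processed (enqueue M p s) = insert M (processed s)"
  "pending (enqueue M p s) = insert (M, p) (pending s)"
  "vec (enqueue M p s) = vec s"
  "shares (enqueue M p s) = shares s"
  "received (enqueue M p s) = received s"
  "local_sn (enqueue M p s) = local_sn s"
  by (auto simp: enqueue_def Let_def add_pred_edge_def add_node_def split: prod.splits)

lemma on_ack_simps [simp]:
  "processed (on_ack C M K sh h s) = processed s"
  "pending (on_ack C M K sh h s) = pending s"
  "vec (on_ack C M K sh h s) = vec s"
  "received (on_ack C M K sh h s) = received s"
  "local_sn (on_ack C M K sh h s) = local_sn s"
  "Node L \<in> nodes (on_ack C M K sh h s) \<longleftrightarrow> Node L \<in> nodes s"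
  "(Node L, v) \<in> edges (on_ack C M K sh h s) \<longleftrightarrow> (Node L, v) \<in> edges s"
  by (auto simp: on_ack_def split: prod.splits)

lemma remove_msg_simps [simp]:
  "processed (remove_msg M p s) = processed s"
  "pending (remove_msg M p s) = pending s - {(M, p)}"
  "vec (remove_msg M p s) = (vec s)(fst M := snd M)"
  "shares (remove_msg M p s) = shares s"
  "received (remove_msg M p s) = received s"
  "local_sn (remove_msg M p s) = local_sn s"
  "nodes (remove_msg M p s) = nodes s - {Node M}"
  "edges (remove_msg M p s) = {(u, v) \<in> edges s. u \<noteq> Node M \<and> v \<noteq> Node M}"
  by (auto simp: remove_msg_def)

lemma shares_on_ack_mono: "shares s L \<subseteq> shares (on_ack C M K sh h s) L"
  by (auto simp: on_ack_def split: prod.splits)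

section \<open>Nodes and edges of the message graph\<close>

lemma Node_relabel_iff: "Node L \<in> relabel M ` A \<longleftrightarrow> Node L \<in> A \<or> (L = M \<and> Temp M \<in> A)"
  by (force simp: relabel_def image_iff)

lemma Node_add_node [simp]:
  "Node L \<in> nodes (add_node M s) \<longleftrightarrow> L = M \<or> Node L \<in> nodes s"
  by (auto simp: add_node_def Node_relabel_iff)

lemma Node_enqueue [simp]:
  "Node L \<in> nodes (enqueue M p s) \<longleftrightarrow> L = M \<or> Node L \<in> nodes s"
proof -
  have "nodes (enqueue M p s) = nodes (add_node M s)"
    by (auto simp: enqueue_def Let_def add_pred_edge_def split: prod.splits)
  then show ?thesis by simp
qed

text \<open>Temporary nodes occur only as sources. Relabelling therefore never moves the target of
  an edge, and removing a message with its incident edges leaves no dangling target.\<close>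

definition edges_to_nodes :: "('p, 'c, 'sh, 'h) pstate \<Rightarrow> bool" where
  "edges_to_nodes s \<longleftrightarrow> (\<forall>(u, v) \<in> edges s. \<exists>M. v = Node M \<and> Node M \<in> nodes s)"

lemma edges_to_nodesD:
  "edges_to_nodes s \<Longrightarrow> (u, v) \<in> edges s \<Longrightarrow> \<exists>M. v = Node M \<and> Node M \<in> nodes s"
  by (auto simp: edges_to_nodes_def)

lemma edges_add_nodeD:
  assumes "(u, v) \<in> edges (add_node M s)" "edges_to_nodes s"
  shows "(u, v) \<in> edges s \<or> (u = Node M \<and> (\<exists>L. v = Node L \<and> Node L \<in> nodes s))"
  using assms by (fastforce simp: add_node_def relabel_def edges_to_nodes_def split: if_splits)

lemma edges_enqueueD:
  assumes "(u, v) \<in> edges (enqueue M p s)" "edges_to_nodes s" "1 \<le> snd M"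
  shows "(u, v) \<in> edges s \<or> (u = Node M \<and> (\<exists>L. v = Node L \<and> Node L \<in> nodes s))"
proof -
  obtain j sn where M: "M = (j, sn)" by fastforce
  have "(u, v) \<in> edges (add_node M s) \<or>
        (u = Node M \<and> v = Node (j, sn - 1) \<and> Node (j, sn - 1) \<in> nodes (add_node M s))"
    using assms(1) by (auto simp: enqueue_def Let_def add_pred_edge_def M split: if_splits)
  then show ?thesis
  proof
    assume "(u, v) \<in> edges (add_node M s)"
    then show ?thesis using assms(2) by (rule edges_add_nodeD)
  \<comment> \<open>As \<open>1 \<le> sn\<close>, the predecessor differs from \<open>M\<close>, so
    its node was there before; for \<open>sn = 0\<close> truncated subtraction would give a loop at
    \<open>M\<close>.\<close>
  qed (use assms(3) M in auto)
qed

lemma edges_to_nodes_on_ack: "edges_to_nodes s \<Longrightarrow> edges_to_nodes (on_ack C M K sh h s)"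
  by (auto simp: edges_to_nodes_def on_ack_def split: prod.splits)

lemma edges_to_nodes_enqueue:
  "edges_to_nodes s \<Longrightarrow> 1 \<le> snd M \<Longrightarrow> edges_to_nodes (enqueue M p s)"
  unfolding edges_to_nodes_def[of "enqueue M p s"]
  by (auto dest!: edges_enqueueD dest: edges_to_nodesD)

section \<open>The invariant of local states\<close>

text \<open>
  Since \<open>vec\<close> counts the removed messages of each process, \<open>snd M \<le> vec s (fst M)\<close> says that
  \<open>M\<close> has been removed.
\<close>

definition consistent :: "('p, 'c, 'sh, 'h) pstate \<Rightarrow> bool" where
  "consistent s \<longleftrightarrow>
     (\<forall>M. Node M \<in> nodes s \<longleftrightarrow> M \<in> processed s \<and> vec s (fst M) < snd M) \<and>
     (\<forall>M. Node M \<in> nodes s \<longrightarrow> (\<exists>p. (M, p) \<in> pending s)) \<and>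
     (\<forall>(M, p) \<in> pending s. M \<in> processed s \<and> (M, p) \<in> received s) \<and>
     (\<forall>j sn. sn \<in> {1..vec s j} \<longrightarrow> (j, sn) \<in> processed s) \<and>
     (\<forall>M \<in> processed s. 1 \<le> snd M) \<and>
     (\<forall>M. finite (shares s M)) \<and>
     edges_to_nodes s"

lemma consistentD:
  assumes "consistent s"
  shows "Node M \<in> nodes s \<longleftrightarrow> M \<in> processed s \<and> vec s (fst M) < snd M"
    and "Node M \<in> nodes s \<Longrightarrow> \<exists>p. (M, p) \<in> pending s"
    and "(M, p) \<in> pending s \<Longrightarrow> M \<in> processed s \<and> (M, p) \<in> received s"
    and "sn \<in> {1..vec s j} \<Longrightarrow> (j, sn) \<in> processed s"
    and "M \<in> processed s \<Longrightarrow> 1 \<le> snd M"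
    and "finite (shares s M)"
    and "edges_to_nodes s"
  using assms by (auto simp: consistent_def)

lemma consistent_init: "consistent init_state"
  by (simp add: consistent_def init_state_def edges_to_nodes_def)

lemma deliverable_iff:
  "deliverable C thr s M p \<longleftrightarrow>
     (M, p) \<in> pending s \<and> vec s (fst M) + 1 = snd M \<and>
     (\<forall>c. p = Cipher c \<longrightarrow> thr \<le> card (fst ` valid_shares C s M c)) \<and>
     (\<forall>v. (Node M, v) \<notin> edges s)"
  by (cases M; cases p) (auto simp: deliverable_def)

lemma ready_iff:
  "ready s M p \<longleftrightarrow>
     1 \<le> snd M \<and> (M, p) \<in> received s \<and> M \<notin> processed s \<and>
     (\<forall>sn\<in>{1..<snd M}. (fst M, sn) \<in> processed s) \<and>
     (\<forall>K sh h. p = Ack K sh h \<longrightarrow> (\<forall>sn\<in>{1..snd K}. (fst K, sn) \<in> processed s))"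
  by (cases M; cases p) (auto simp: ready_def)

lemma finite_shares_on_ack:
  "finite (shares s L) \<Longrightarrow> finite (shares (on_ack C M K sh h s) L)"
  by (auto simp: on_ack_def split: prod.splits)

lemma consistent_enqueue:
  assumes "consistent s" "(M, p) \<in> received s" "1 \<le> snd M" "M \<notin> processed s"
  shows "consistent (enqueue M p s)"
proof -
  \<comment> \<open>Only processed messages are counted by \<open>vec\<close>, so a message being
    handled is not counted as removed and may get a node.\<close>
  have "vec s (fst M) < snd M"
    using consistentD(4)[OF assms(1), of "snd M" "fst M"] assms(3,4) by (auto simp: not_le[symmetric])
  then show ?thesis
    using assms by (auto simp: consistent_def edges_to_nodes_enqueue)
qed

lemma consistent_on_ack: "consistent s \<Longrightarrow> consistent (on_ack C M K sh h s)"
  by (simp add: consistent_def finite_shares_on_ack edges_to_nodes_on_ack)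

lemma consistent_remove_msg:
  assumes "consistent s" "(M, p) \<in> pending s" "vec s (fst M) + 1 = snd M"
    and unique: "\<And>q. (M, q) \<in> received s \<Longrightarrow> q = p"
  shows "consistent (remove_msg M p s)"
proof -
  obtain j sn where M: "M = (j, sn)" by fastforce
  let ?s = "remove_msg M p s"
  \<comment> \<open>The entry of \<open>j\<close> grows by exactly one, so \<open>M\<close> is the
    only message that becomes counted as removed.\<close>
  have "\<forall>L. Node L \<in> nodes ?s \<longleftrightarrow> L \<in> processed ?s \<and> vec ?s (fst L) < snd L"
    using assms(1,3) by (force simp: consistent_def M)
  moreover have "\<forall>L. Node L \<in> nodes ?s \<longrightarrow> (\<exists>p. (L, p) \<in> pending ?s)"
    using consistentD(2)[OF assms(1)] by fastforce
  moreover have "\<forall>i n. n \<in> {1..vec ?s i} \<longrightarrow> (i, n) \<in> processed ?s"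
  proof (intro allI impI)
    fix i n assume n: "n \<in> {1..vec ?s i}"
    have "(j, sn) \<in> processed s" using assms(1,2) by (auto simp: consistent_def M)
    moreover have "n = sn \<or> n \<in> {1..vec s i}" if "i = j" using n that assms(3) by (auto simp: M)
    moreover have "n \<in> {1..vec s i}" if "i \<noteq> j" using n that by (auto simp: M)
    ultimately show "(i, n) \<in> processed ?s"
      using consistentD(4)[OF assms(1), of n i] by (cases "i = j") auto
  qed
  moreover have "edges_to_nodes ?s"
    using assms(1) by (fastforce simp: consistent_def edges_to_nodes_def)
  ultimately show ?thesis
    using assms(1) by (auto simp: consistent_def)
qed

lemma consistent_step:
  assumes "step C thr i s a s'" "consistent s"
    and unique: "\<And>M p q. (M, p) \<in> received s \<Longrightarrow> (M, q) \<in> received s \<Longrightarrow> p = q"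
  shows "consistent s'"
  using assms(1)
proof cases
  case (bcrb_broadcast sn c m r)
  then show ?thesis using assms(2) by (auto simp: consistent_def edges_to_nodes_def)
next
  case (brb_deliver M p)
  then show ?thesis using assms(2) by (auto simp: consistent_def edges_to_nodes_def)
next
  case (handle_ack M K sh h)
  then show ?thesis
    using assms(2) by (auto simp: ready_iff intro!: consistent_enqueue consistent_on_ack)
next
  case (handle_cipher M c sn)
  moreover have "consistent (s\<lparr>local_sn := sn\<rparr>)"
    using assms(2) by (auto simp: consistent_def edges_to_nodes_def)
  ultimately show ?thesis by (auto simp: ready_iff intro!: consistent_enqueue)
next
  case (deliver_ack M K sh h)
  moreover from this have "(M, Ack K sh h) \<in> received s"
    using assms(2) by (auto simp: deliverable_iff consistent_def)
  ultimately show ?thesis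
    using consistent_remove_msg[OF assms(2)] unique by (auto simp: deliverable_iff)
next
  case (deliver_cipher M c)
  moreover from this have "(M, Cipher c) \<in> received s"
    using assms(2) by (auto simp: deliverable_iff consistent_def)
  ultimately show ?thesis
    using consistent_remove_msg[OF assms(2)] unique by (auto simp: deliverable_iff)
next
  case idle
  then show ?thesis using assms(2) by simp
qed

section \<open>Monotonicity and the origin of changes in a single step\<close>

lemma step_mono:
  assumes "step C thr i s a s'"
  shows "processed s \<subseteq> processed s'" "received s \<subseteq> received s'"
    "shares s M \<subseteq> shares s' M" "vec s j \<le> vec s' j"
  using assms subsetD[OF shares_on_ack_mono]
  by (cases; fastforce simp: deliverable_iff)+

lemma step_received:
  "step C thr i s a s' \<Longrightarrow> (M, p) \<in> received s' \<longleftrightarrow> (M, p) \<in> received s \<or> a = Brb_Deliver M p"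
  by (erule step.cases) auto

lemma step_processed:
  "step C thr i s a s' \<Longrightarrow> M \<in> processed s' \<Longrightarrow>
    M \<in> processed s \<or> (\<exists>p out. a = Handle M p out)"
  by (erule step.cases) auto

lemma step_vec:
  "step C thr i s a s' \<Longrightarrow> vec s j < sn \<Longrightarrow> sn \<le> vec s' j \<Longrightarrow> \<exists>out. a = Deliver (j, sn) out"
  by (erule step.cases) (auto simp: deliverable_iff split: if_splits)

lemma step_HandleD:
  "step C thr i s (Handle M p out) s' \<Longrightarrow> ready s M p \<and> M \<in> processed s'"
  by (erule step.cases) auto

lemma step_DeliverD:
  "step C thr i s (Deliver M out) s' \<Longrightarrow>
    \<exists>p. deliverable C thr s M p \<and> vec s' (fst M) = snd M \<and>
      out = (case p of Cipher c \<Rightarrow> Some (combine C c (valid_shares C s M c)) | _ \<Rightarrow> None)"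
  by (erule step.cases) auto

text \<open>A new edge out of \<open>Node M\<close> can only come from the handler of
  \<open>M\<close>, which relabels \<open>Temp M\<close> and adds the edge to the predecessor. By
  \<open>edges_to_nodes\<close> the targets are nodes already present, hence processed
  messages.\<close>

lemma step_edges:
  assumes "step C thr i s a s'" "consistent s" "(Node M, v) \<in> edges s'"
  shows "(Node M, v) \<in> edges s \<or> (M \<notin> processed s \<and> (\<exists>L. v = Node L \<and> L \<in> processed s))"
  using assms(1)
proof cases
  case (handle_ack L K sh h)
  let ?s = "on_ack C L K sh h s"
  have "edges_to_nodes ?s" using assms(2) by (simp add: consistent_def edges_to_nodes_on_ack)
  then show ?thesis
    using edges_enqueueD[of "Node M" v L _ ?s] handle_ack assms(2,3)
    by (auto simp: ready_iff consistent_def)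
next
  case (handle_cipher L c sn)
  let ?s = "s\<lparr>local_sn := sn\<rparr>"
  have "edges_to_nodes ?s" using assms(2) by (auto simp: consistent_def edges_to_nodes_def)
  then show ?thesis
    using edges_enqueueD[of "Node M" v L _ ?s] handle_cipher assms(2,3)
    by (auto simp: ready_iff consistent_def)
qed (use assms(3) in auto)


section \<open>Runs\<close>

text \<open>The bound on the number of Byzantine processes enters through \<open>thr_le\<close>: the
  correct processes alone can supply enough shares.\<close>

locale protocol_run =
  fixes thr :: nat and Corr :: "'p::finite set"
    and C :: "('p, 'pk, 'sk, 'm, 'r, 'c, 'sh, 'h) crypto"
    and ev :: "('p, 'm, 'c, 'sh, 'h) trace"
    and st :: "nat \<Rightarrow> 'p \<Rightarrow> ('p, 'c, 'sh, 'h) pstate"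
  assumes thr_le: "thr \<le> card Corr"
    and enc: "threshold_encryption C thr"
    and exec: "execution C thr Corr ev st"
    and fairness: "fair C thr Corr ev st"
    and validity: "rb_validity Corr (brb_bc ev) (brb_dl ev)"
    and agreement: "rb_agreement Corr (brb_dl ev)"
    and integrity: "rb_integrity Corr (brb_bc ev) (brb_dl ev)"
begin

section \<open>Invariants and BRB guarantees along a run\<close>

lemma init: "k \<in> Corr \<Longrightarrow> st 0 k = init_state"
  using exec by (simp add: execution_def)

lemma step_ev: "k \<in> Corr \<Longrightarrow> ev t = (k, a) \<Longrightarrow> step C thr k (st t k) a (st (Suc t) k)"
  using exec by (metis execution_def fst_conv snd_conv)

lemma step_or_same:
  assumes "k \<in> Corr"
  obtains a where "ev t = (k, a)" "step C thr k (st t k) a (st (Suc t) k)"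
  | "\<And>a. ev t \<noteq> (k, a)" "st (Suc t) k = st t k"
proof (cases "fst (ev t) = k")
  case True
  then have "ev t = (k, snd (ev t))" by auto
  then show ?thesis using that(1) step_ev[OF assms] by blast
next
  case False
  then have "st (Suc t) k = st t k" using exec assms by (auto simp: execution_def)
  then show ?thesis using that(2) False by force
qed

lemma HandleD:
  assumes "k \<in> Corr" "ev t = (k, Handle M p out)"
  shows "ready (st t k) M p" and "M \<in> processed (st (Suc t) k)" and "(M, p) \<in> received (st t k)"
  using step_HandleD[OF step_ev[OF assms]] by (simp_all add: ready_iff)

lemma processed_Suc:
  assumes "k \<in> Corr" "M \<in> processed (st (Suc t) k)"
  shows "M \<in> processed (st t k) \<or> (\<exists>p out. ev t = (k, Handle M p out))"
  by (cases rule: step_or_same[OF assms(1), of t]) (use assms(2) step_processed in fastforce)+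

lemma mono:
  assumes "k \<in> Corr" "t \<le> t'"
  shows processed_mono: "processed (st t k) \<subseteq> processed (st t' k)"
    and received_mono: "received (st t k) \<subseteq> received (st t' k)"
    and shares_mono: "shares (st t k) M \<subseteq> shares (st t' k) M"
    and vec_mono: "vec (st t k) j \<le> vec (st t' k) j"
proof -
  have "processed (st t k) \<subseteq> processed (st t' k) \<and>
    received (st t k) \<subseteq> received (st t' k) \<and>
    shares (st t k) M \<subseteq> shares (st t' k) M \<and> vec (st t k) j \<le> vec (st t' k) j"
    using assms(2)
  proof (induction t' rule: dec_induct)
    case (step t')
    then show ?case
    proof (cases rule: step_or_same[OF assms(1), of t'])
      case 1
      note mono = step_mono[OF 1(2)]
      show ?thesis
        using step.IH mono(1,2) mono(3)[of M] mono(4)[of j]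
        by - (elim conjE, intro conjI; erule order_trans, assumption)
    qed simp
  qed simp
  then show "processed (st t k) \<subseteq> processed (st t' k)" "received (st t k) \<subseteq> received (st t' k)"
    "shares (st t k) M \<subseteq> shares (st t' k) M" "vec (st t k) j \<le> vec (st t' k) j"
    by blast+
qed

lemma received_iff:
  assumes "k \<in> Corr"
  shows "(M, p) \<in> received (st t k) \<longleftrightarrow> (\<exists>t0<t. brb_dl ev t0 k M p)"
proof (induction t)
  case 0
  then show ?case using init[OF assms] by (simp add: init_state_def)
next
  case (Suc t)
  then show ?case
    by (cases rule: step_or_same[OF assms, of t])
      (auto simp: step_received brb_dl_def less_Suc_eq)
qed

lemma received_unique:
  assumes "k \<in> Corr" "(M, p) \<in> received (st t k)" "(M, q) \<in> received (st t' k)"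
  shows "p = q"
  using assms integrity by (auto simp: received_iff rb_integrity_def)

lemma received_agreement:
  assumes "i \<in> Corr" "k \<in> Corr" "(M, p) \<in> received (st t i)"
  obtains t0 where "brb_dl ev t0 k M p"
proof -
  obtain t' where "brb_dl ev t' i M p" using assms(1,3) by (auto simp: received_iff)
  then show thesis using that agreement assms(1,2) unfolding rb_agreement_def by blast
qed

lemma brb_validityE:
  assumes "i \<in> Corr" "k \<in> Corr" "brb_bc ev t (i, sn) p"
  obtains t0 where "t \<le> t0" "brb_dl ev t0 k (i, sn) p"
  using that validity assms unfolding rb_validity_def by blast

lemma received_unique':
  assumes "i \<in> Corr" "k \<in> Corr" "(M, p) \<in> received (st t i)" "(M, q) \<in> received (st t' k)"
  shows "p = q"
proof -
  obtain t0 where "brb_dl ev t0 k M p" using received_agreement[OF assms(1-3)] .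
  then have "(M, p) \<in> received (st (Suc t0) k)" using assms by (auto simp: received_iff)
  then show ?thesis using received_unique assms by blast
qed

lemma consistent: "k \<in> Corr \<Longrightarrow> consistent (st t k)"
proof (induction t)
  case 0
  then show ?case by (simp add: init consistent_init)
next
  case (Suc t)
  then show ?case
    by (cases rule: step_or_same[OF Suc.prems, of t])
      (auto intro: consistent_step dest: received_unique)
qed

section \<open>Correct processes handle the same messages\<close>

lemma eventually_processed:
  assumes k: "k \<in> Corr" and dl: "brb_dl ev t0 k M p" and "1 \<le> snd M"
    and pred: "\<forall>sn\<in>{1..<snd M}. (fst M, sn) \<in> processed (st T k)"
    and ack: "\<And>K sh h. p = Ack K sh h \<Longrightarrow> \<forall>sn\<in>{1..snd K}. (fst K, sn) \<in> processed (st T k)"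
  shows "\<exists>T'. M \<in> processed (st T' k)"
proof (rule ccontr)
  assume *: "\<not> ?thesis"
  \<comment> \<open>A delivery at \<open>t0\<close> shows in \<open>received\<close> from
    \<open>Suc t0\<close> on. Waits that are over at \<open>T\<close> are still over at
    \<open>?T\<close>, and by the contrary assumption \<open>M\<close> is not handled by
    then.\<close>
  let ?T = "max T (Suc t0)"
  have "(M, p) \<in> received (st ?T k)" using dl k by (auto simp: received_iff less_max_iff_disj)
  moreover have "processed (st T k) \<subseteq> processed (st ?T k)" using processed_mono[OF k] by simp
  ultimately have "ready (st ?T k) M p"
    using assms * by (auto simp: ready_iff)
  then obtain t out where "ev t = (k, Handle M p out)"
    using fairness k unfolding fair_def by blast
  then show False using * HandleD(2)[OF k] by blast
qed

lemma processed_handled: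
  assumes "k \<in> Corr" "M \<in> processed (st t k)"
  shows "\<exists>t0<t. \<exists>p out. ev t0 = (k, Handle M p out)"
  using assms(2)
proof (induction t)
  case 0
  then show ?case using init[OF assms(1)] by (simp add: init_state_def)
next
  case (Suc t)
  then show ?case using processed_Suc[OF assms(1), of M t] less_SucI by blast
qed

text \<open>Whatever the handler of \<open>M\<close> waited for at \<open>i\<close> was processed
  there before, so by induction it is eventually processed at \<open>k\<close>. BRB Agreement gives
  \<open>k\<close> the same payload, hence the same waits. The sender of \<open>M\<close> may be
  Byzantine.\<close>

lemma processed_agreement:
  assumes i: "i \<in> Corr" and k: "k \<in> Corr"
  shows "\<exists>T. processed (st t i) \<subseteq> processed (st T k)"
proof (induction t)
  case 0
  then show ?case by (simp add: init[OF i] init_state_def)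
next
  case (Suc t)
  then obtain T where T: "processed (st t i) \<subseteq> processed (st T k)" by blast
  show ?case
  proof (cases "\<exists>M p out. ev t = (i, Handle M p out)")
    case True
    then obtain M p out where ev: "ev t = (i, Handle M p out)" by blast
    note step = step_ev[OF i ev]
    have ready: "ready (st t i) M p" using HandleD(1)[OF i ev] .
    then obtain t0 where t0: "brb_dl ev t0 k M p"
      using received_agreement[OF i k, of M p t] by (auto simp: ready_iff)
    have "\<exists>T'. M \<in> processed (st T' k)"
      using ready T by (intro eventually_processed[OF k t0, of T]) (auto simp: ready_iff)
    then obtain T' where "M \<in> processed (st T' k)" by blast
    then have "insert M (processed (st t i)) \<subseteq> processed (st (max T T') k)"
      using T processed_mono[OF k, of T "max T T'"] processed_mono[OF k, of T' "max T T'"] by auto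
    moreover have "processed (st (Suc t) i) \<subseteq> insert M (processed (st t i))"
      using step_processed[OF step] by blast
    ultimately show ?thesis by blast
  next
    case False
    then have "processed (st (Suc t) i) \<subseteq> processed (st t i)"
      using processed_Suc[OF i] by blast
    then show ?thesis using T by blast
  qed
qed

section \<open>Broadcasts and decryption shares of correct processes reach every correct
  process\<close>

lemma local_sn_increases:
  assumes i: "i \<in> Corr" and neq: "local_sn (st t i) \<noteq> local_sn (st (Suc t) i)"
  obtains p where "local_sn (st (Suc t) i) = Suc (local_sn (st t i))"
    "brb_bc ev t (i, Suc (local_sn (st t i))) p"
    "\<And>K sh h. p = Ack K sh h \<Longrightarrow>
       \<forall>sn\<in>{1..snd K}. (fst K, sn) \<in> processed (st (Suc t) i)"
proof (cases rule: step_or_same[OF i, of t])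
  case 1
  from 1(2) show ?thesis
  proof cases
    case (bcrb_broadcast sn c m r)
    then show ?thesis
      using 1(1) by (intro that[of "Cipher c"]) (auto simp: brb_bc_def)
  next
    case (handle_cipher M c sn)
    let ?p = "Ack M (dec_share C (key_share C i) c) (hash C c)"
    have "brb_bc ev t (i, sn) ?p"
      using handle_cipher(1) 1(1) by (force simp: brb_bc_def)
    \<comment> \<open>The range includes \<open>M\<close> itself, which becomes processed only in
      this step; hence the state at \<open>Suc t\<close>.\<close>
    moreover have "\<forall>n\<in>{1..snd M}. (fst M, n) \<in> processed (st (Suc t) i)"
    proof
      fix n assume "n \<in> {1..snd M}"
      then have "(fst M, n) = M \<or> n \<in> {1..<snd M}" by (cases M) auto
      then show "(fst M, n) \<in> processed (st (Suc t) i)"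
        using handle_cipher by (auto simp: ready_iff)
    qed
    ultimately show ?thesis
      using handle_cipher by (intro that[of ?p]) auto
  qed (use neq in auto)
qed (use neq in auto)

text \<open>A correct process numbers its broadcasts without gaps, so the waits for smaller numbers
  end by induction. Its ACKs concern messages that it has handled with all their predecessors, and
  \<open>processed_agreement\<close> transfers these to \<open>k\<close>. That lemma does not cover
  the broadcast itself, which \<open>i\<close> need not have handled; BRB Validity brings it to
  \<open>k\<close>.\<close>

lemma broadcasts_processed:
  assumes i: "i \<in> Corr" and k: "k \<in> Corr"
  shows "\<exists>T. \<forall>sn\<in>{1..local_sn (st t i)}. (i, sn) \<in> processed (st T k)"
proof (induction t)
  case 0
  then show ?case by (simp add: init[OF i] init_state_def)
next
  case (Suc t)
  let ?sn = "Suc (local_sn (st t i))"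
  from Suc obtain T where T: "\<forall>sn\<in>{1..local_sn (st t i)}. (i, sn) \<in> processed (st T k)" by blast
  show ?case
  proof (cases "local_sn (st t i) = local_sn (st (Suc t) i)")
    case True
    then show ?thesis using T by auto
  next
    case False
    from local_sn_increases[OF i False] obtain p where
      p: "local_sn (st (Suc t) i) = ?sn" "brb_bc ev t (i, ?sn) p"
      and ack: "\<And>K sh h. p = Ack K sh h \<Longrightarrow>
         \<forall>sn\<in>{1..snd K}. (fst K, sn) \<in> processed (st (Suc t) i)"
      by metis
    obtain t0 where t0: "brb_dl ev t0 k (i, ?sn) p"
      using brb_validityE[OF i k p(2)] .
    obtain T' where T': "processed (st (Suc t) i) \<subseteq> processed (st T' k)"
      using processed_agreement[OF i k] by blast
    let ?T = "max T T'"
    have sub: "processed (st T k) \<subseteq> processed (st ?T k)" "processed (st T' k) \<subseteq> processed (st ?T k)"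
      using processed_mono[OF k] by simp_all
    have "\<exists>T'. (i, ?sn) \<in> processed (st T' k)"
    proof (rule eventually_processed[OF k t0])
      show "\<forall>sn\<in>{1..<snd (i, ?sn)}. (fst (i, ?sn), sn) \<in> processed (st ?T k)"
        using T sub(1) by auto
      show "\<forall>sn\<in>{1..snd K}. (fst K, sn) \<in> processed (st ?T k)" if "p = Ack K sh h" for K sh h
        using ack[OF that] T' sub(2) by blast
    qed simp
    then obtain T'' where "(i, ?sn) \<in> processed (st T'' k)" by blast
    then have "\<forall>sn\<in>{1..?sn}. (i, sn) \<in> processed (st (max T T'') k)"
      using T processed_mono[OF k, of T "max T T''"] processed_mono[OF k, of T'' "max T T''"]
      by (auto simp: atLeastAtMostSuc_conv)
    then show ?thesis unfolding p(1) by blast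
  qed
qed

text \<open>The first alternative is the race: once the node of \<open>M\<close> is gone at
  \<open>k\<close>, \<open>on_ack\<close> discards the share. Otherwise the test in
  \<open>on_ack\<close> succeeds, because the ACK waits for \<open>M\<close> and both processes hold
  the same ciphertext.\<close>

lemma share_arrives:
  assumes i: "i \<in> Corr" and k: "k \<in> Corr"
    and M: "M \<in> processed (st t k)" "(M, Cipher c) \<in> received (st t k)"
  shows "\<exists>T. snd M \<le> vec (st T k) (fst M) \<or> i \<in> fst ` valid_shares C (st T k) M c"
proof -
  obtain t1 where "M \<in> processed (st t1 i)" using processed_agreement[OF k i] M(1) by blast
  then obtain t0 p out where ev: "ev t0 = (i, Handle M p out)"
    using processed_handled[OF i] by blast
  then have "(M, p) \<in> received (st t0 i)" by (rule HandleD(3)[OF i])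
  then have p: "p = Cipher c" using received_unique' i k M(2) by blast
  let ?sh = "dec_share C (key_share C i) c" and ?sn = "local_sn (st t0 i) + 1"
  have out: "out = Some (?sn, Ack M ?sh (hash C c))"
    "local_sn (st (Suc t0) i) = ?sn"
    using step_ev[OF i ev] by (auto simp: p elim: step.cases)
  obtain T where "(i, ?sn) \<in> processed (st T k)"
    using broadcasts_processed[OF i k, of "Suc t0"] out(2) by fastforce
  then obtain t2 q out' where ev2: "ev t2 = (k, Handle (i, ?sn) q out')"
    using processed_handled[OF k] by blast
  note step = step_ev[OF k ev2]
  have ready: "ready (st t2 k) (i, ?sn) q" using HandleD(1)[OF k ev2] .
  have "brb_bc ev t0 (i, ?sn) (Ack M ?sh (hash C c))"
    using ev out by (auto simp: brb_bc_def)
  then obtain t3 where "brb_dl ev t3 k (i, ?sn) (Ack M ?sh (hash C c))"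
    using brb_validityE[OF i k] by blast
  then have "((i, ?sn), Ack M ?sh (hash C c)) \<in> received (st (Suc t3) k)"
    using k by (auto simp: received_iff)
  then have q: "q = Ack M ?sh (hash C c)"
    using received_unique[OF k] ready by (auto simp: ready_iff)
  have snd_M: "1 \<le> snd M" using consistentD(5)[OF consistent[OF k] M(1)] .
  \<comment> \<open>The second wait of the ACK handler, taken at the index \<open>snd M\<close>; it
    lies in the range because it is at least \<open>1\<close>.\<close>
  then have proc: "M \<in> processed (st t2 k)"
    using ready unfolding q by (cases M) (auto simp: ready_iff)
  \<comment> \<open>The time \<open>t\<close> may be later than \<open>t2\<close>, but
    \<open>M\<close> was handled before \<open>t2\<close>, so it had been received by then, with the
    only content possible.\<close>
  have rcv: "(M, Cipher c) \<in> received (st t2 k)"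
  proof -
    from processed_handled[OF k proc] obtain t4 p' o' where
      *: "t4 < t2" "ev t4 = (k, Handle M p' o')" by blast
    from HandleD(3)[OF k this(2)] show ?thesis
      using received_unique[OF k _ M(2)] received_mono[OF k, of t4 t2] *(1) by auto
  qed
  show ?thesis
  proof (cases "Node M \<in> nodes (st t2 k)")
    case True
    have "(i, ?sh) \<in> shares (st (Suc t2) k) M"
      using step True rcv unfolding q by cases (auto simp: on_ack_def)
    moreover have "valid_share C c i ?sh" using enc unfolding threshold_encryption_def by blast
    ultimately have "(i, ?sh) \<in> valid_shares C (st (Suc t2) k) M c" by (simp add: valid_shares_def)
    then show ?thesis by force
  next
    case False
    then have "snd M \<le> vec (st t2 k) (fst M)"
      using consistent[OF k, of t2] proc by (auto simp: consistent_def not_less)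
    then show ?thesis by blast
  qed
qed

text \<open>Stated for all sufficiently late times, so that it can be combined with other conditions
  at a common time.\<close>

lemma shares_arrive:
  assumes k: "k \<in> Corr" and M: "M \<in> processed (st t k)" "(M, Cipher c) \<in> received (st t k)"
  shows "\<exists>T. \<forall>t\<ge>T. snd M \<le> vec (st t k) (fst M) \<or> thr \<le> card (fst ` valid_shares C (st t k) M c)"
proof -
  obtain T where T: "\<And>i. i \<in> Corr \<Longrightarrow>
      snd M \<le> vec (st (T i) k) (fst M) \<or> i \<in> fst ` valid_shares C (st (T i) k) M c"
    using share_arrives[OF _ k M] by metis
  have "snd M \<le> vec (st t k) (fst M) \<or> thr \<le> card (fst ` valid_shares C (st t k) M c)"
    if "Max (T ` Corr) \<le> t" for t
  proof (rule disjCI)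
    assume *: "\<not> thr \<le> card (fst ` valid_shares C (st t k) M c)"
    \<comment> \<open>Since \<open>thr \<le> card Corr\<close>, too few shares means that the share
      of some correct \<open>i\<close> is missing. As \<open>T i\<close> has passed and shares are
      never lost, \<open>M\<close> must have been removed.\<close>
    have "\<not> Corr \<subseteq> fst ` valid_shares C (st t k) M c"
      using * thr_le card_mono[of "fst ` valid_shares C (st t k) M c" Corr] by auto
    then obtain i where i: "i \<in> Corr" "i \<notin> fst ` valid_shares C (st t k) M c" by blast
    then have le: "T i \<le> t" using that by (meson Max_ge finite finite_imageI imageI le_trans)
    have "valid_shares C (st (T i) k) M c \<subseteq> valid_shares C (st t k) M c"
      using shares_mono[OF k le, of M] by (auto simp: valid_shares_def)
    then have "snd M \<le> vec (st (T i) k) (fst M)" using T[OF i(1)] i(2) by blast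
    then show "snd M \<le> vec (st t k) (fst M)" using vec_mono[OF k le] le_trans by blast
  qed
  then show ?thesis by blast
qed

section \<open>Progress: every handled message is removed\<close>

lemma out_edges_mono:
  assumes k: "k \<in> Corr" and M: "M \<in> processed (st t k)" and "t \<le> t'"
    and "(Node M, v) \<in> edges (st t' k)"
  shows "(Node M, v) \<in> edges (st t k)"
  using assms(3,4)
proof (induction t' rule: dec_induct)
  case (step t')
  \<comment> \<open>This rules out the alternative of \<open>step_edges\<close> in which an edge is
    new.\<close>
  have "M \<in> processed (st t' k)" using M processed_mono[OF k step(1)] by blast
  then have "(Node M, v) \<in> edges (st t' k)"
    using step.prems step_edges[OF _ consistent[OF k, of t'], of C thr k _ _ M v]
    by (cases rule: step_or_same[OF k, of t']) auto
  then show ?case by (rule step.IH)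
qed simp

text \<open>If the message \<open>M\<close> handled at time \<open>t\<close> were never removed, its
  node and its pending entry would persist, while every obstacle to its removal disappears. Fairness
  then yields a \<open>Deliver\<close> step for \<open>M\<close>, which raises \<open>vec\<close> to
  \<open>snd M\<close>.\<close>

lemma eventually_removed:
  assumes k: "k \<in> Corr"
  shows "\<exists>T. \<forall>M\<in>processed (st t k). snd M \<le> vec (st T k) (fst M)"
proof (induction t)
  case 0
  then show ?case by (simp add: init[OF k] init_state_def)
next
  case (Suc t)
  then obtain T where T: "\<forall>M\<in>processed (st t k). snd M \<le> vec (st T k) (fst M)" by blast
  show ?case
  proof (cases "\<exists>M p out. ev t = (k, Handle M p out)")
    case True
    then obtain M p out where ev: "ev t = (k, Handle M p out)" by blast
    note step = step_ev[OF k ev]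
    have ready: "ready (st t k) M p" and proc: "M \<in> processed (st (Suc t) k)"
      using HandleD[OF k ev] by blast+
    have "\<exists>T'. snd M \<le> vec (st T' k) (fst M)"
    proof (rule ccontr)
      assume "\<not> ?thesis"
      then have not_removed: "vec (st t' k) (fst M) < snd M" for t' by (simp add: not_le)
      have rcv: "(M, p) \<in> received (st (Suc t) k)"
        using ready received_mono[OF k, of t "Suc t"] by (auto simp: ready_iff)
      obtain T1 where T1:
        "\<And>c t'. p = Cipher c \<Longrightarrow> T1 \<le> t' \<Longrightarrow> thr \<le> card (fst ` valid_shares C (st t' k) M c)"
      proof (cases p)
        case (Cipher c)
        then show ?thesis
          using that shares_arrive[OF k proc, of c] rcv not_removed by (auto simp: not_le[symmetric])
      qed (use that in simp)
      \<comment> \<open>By \<open>?T\<close> three things hold: \<open>M\<close> has been handled,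
        all messages handled before it have been removed, and, if it is a ciphertext, its shares
        suffice from \<open>T1\<close> on.\<close>
      let ?T = "max (Suc t) (max T T1)"
      have T': "\<forall>L\<in>processed (st t k). snd L \<le> vec (st ?T k) (fst L)"
        using T vec_mono[OF k, of T ?T] by (meson le_trans max.cobounded1 max.cobounded2)
      \<comment> \<open>An edge left at \<open>?T\<close> already existed when \<open>M\<close> had
        just been handled, so its target was handled before \<open>M\<close> and has been removed by
        \<open>?T\<close>. But targets of edges are nodes, that is, messages not yet
        removed.\<close>
      have no_edge: "(Node M, v) \<notin> edges (st ?T k)" for v
      proof
        assume v: "(Node M, v) \<in> edges (st ?T k)"
        then have v': "(Node M, v) \<in> edges (st (Suc t) k)"
          by (rule out_edges_mono[OF k proc max.cobounded1])
        have cons: "consistent (st t k)" "consistent (st ?T k)" using consistent[OF k] by blast+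
        have "\<exists>L. v = Node L \<and> L \<in> processed (st t k)"
          using step_edges[OF step cons(1) v'] edges_to_nodesD[OF consistentD(7)[OF cons(1)]]
            consistentD(1)[OF cons(1)] by blast
        then obtain L where L: "v = Node L" "L \<in> processed (st t k)" by blast
        then have "Node L \<in> nodes (st ?T k)"
          using edges_to_nodesD[OF consistentD(7)[OF cons(2)] v] by simp
        then have "vec (st ?T k) (fst L) < snd L" using consistentD(1)[OF cons(2)] by blast
        then show False using T' L(2) not_le by blast
      qed
      have proc': "M \<in> processed (st ?T k)"
        using proc processed_mono[OF k, of "Suc t" ?T] by auto
      then have "Node M \<in> nodes (st ?T k)"
        using not_removed consistentD(1)[OF consistent[OF k]] by blast
      then obtain q where q: "(M, q) \<in> pending (st ?T k)"
        using consistentD(2)[OF consistent[OF k]] by blast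
      then have "(M, q) \<in> received (st ?T k)" using consistentD(3)[OF consistent[OF k]] by blast
      then have "q = p" using rcv by (rule received_unique[OF k])
      with q have "(M, p) \<in> pending (st ?T k)" by simp
      \<comment> \<open>The FIFO wait put the predecessor before \<open>M\<close>, so it has been
        removed by \<open>?T\<close>; this is the lower bound, trivial for \<open>snd M = 1\<close>.
        The upper bound is that \<open>M\<close> is not removed.\<close>
      moreover have "vec (st ?T k) (fst M) + 1 = snd M"
      proof -
        have "snd M - 1 \<le> vec (st ?T k) (fst M)"
        proof (cases "snd M = 1")
          case False
          then have "(fst M, snd M - 1) \<in> processed (st t k)"
            using ready by (auto simp: ready_iff)
          then show ?thesis using T' by fastforce
        qed simp
        then show ?thesis using not_removed[of ?T] by simp
      qed
      ultimately have "deliverable C thr (st ?T k) M p"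
        using no_edge T1 by (simp add: deliverable_iff)
      then obtain t' out' where "ev t' = (k, Deliver M out')"
        using fairness k unfolding fair_def by blast
      then have "vec (st (Suc t') k) (fst M) = snd M"
        using step_DeliverD[OF step_ev[OF k]] by blast
      then show False using not_removed[of "Suc t'"] by simp
    qed
    then obtain T' where T': "snd M \<le> vec (st T' k) (fst M)" by blast
    have "\<forall>L\<in>processed (st (Suc t) k). snd L \<le> vec (st (max T T') k) (fst L)"
    proof
      fix L assume "L \<in> processed (st (Suc t) k)"
      then have "L = M \<or> L \<in> processed (st t k)" using step_processed[OF step] by blast
      then show "snd L \<le> vec (st (max T T') k) (fst L)"
        using T T' vec_mono[OF k, of T "max T T'"] vec_mono[OF k, of T' "max T T'"]
        by (meson le_trans max.cobounded1 max.cobounded2)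
    qed
    then show ?thesis by blast
  next
    case False
    then have "processed (st (Suc t) k) \<subseteq> processed (st t k)"
      using processed_Suc[OF k] by blast
    then show ?thesis using T by blast
  qed
qed

section \<open>From removals to BCRB deliveries of plaintexts\<close>

lemma DeliverE:
  assumes k: "k \<in> Corr" and "ev t = (k, Deliver M out)"
  obtains p where "M \<in> processed (st t k)" "(M, p) \<in> received (st t k)" "deliverable C thr (st t k) M p"
    "out = (case p of Cipher c \<Rightarrow> Some (combine C c (valid_shares C (st t k) M c)) | _ \<Rightarrow> None)"
proof -
  obtain p where p: "deliverable C thr (st t k) M p"
    "out = (case p of Cipher c \<Rightarrow> Some (combine C c (valid_shares C (st t k) M c)) | _ \<Rightarrow> None)"
    using step_DeliverD[OF step_ev[OF assms]] by blast
  then have "M \<in> processed (st t k) \<and> (M, p) \<in> received (st t k)"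
    using consistent[OF k, of t] by (auto simp: consistent_def deliverable_iff)
  then show thesis using that p by blast
qed

lemma deliverable_enough_shares:
  assumes "k \<in> Corr" "deliverable C thr (st t k) M (Cipher c)"
  shows "enough_shares C thr c (valid_shares C (st t k) M c)"
proof -
  have "finite (shares (st t k) M)" using consistent[OF assms(1)] by (auto simp: consistent_def)
  then have "finite (valid_shares C (st t k) M c)"
    by (rule rev_finite_subset) (auto simp: valid_shares_def)
  then show ?thesis
    using assms(2) by (auto simp: enough_shares_def valid_shares_def deliverable_iff)
qed

lemma bcrb_dlE:
  assumes k: "k \<in> Corr" and "bcrb_dl ev t k M m"
  obtains c S where "M \<in> processed (st t k)" "(M, Cipher c) \<in> received (st t k)"
    "enough_shares C thr c S" "m = combine C c S"
proof -
  have "ev t = (k, Deliver M (Some m))" using assms by (simp add: bcrb_dl_def)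
  then obtain p where p: "M \<in> processed (st t k)" "(M, p) \<in> received (st t k)"
    "deliverable C thr (st t k) M p"
    "Some m = (case p of Cipher c \<Rightarrow> Some (combine C c (valid_shares C (st t k) M c)) | _ \<Rightarrow> None)"
    by (rule DeliverE[OF k])
  then obtain c where "p = Cipher c" by (cases p) auto
  with p show thesis
    using that[of c "valid_shares C (st t k) M c"] deliverable_enough_shares[OF k, of t M c] by simp
qed

text \<open>Turns the growth of \<open>vec\<close> into a delivery event. The last conjunct dates
  that event after the BRB delivery of the ciphertext, as needed for the time bound in
  Validity.\<close>

lemma processed_bcrb_dl:
  assumes k: "k \<in> Corr" and M: "M \<in> processed (st t k)" "(M, Cipher c) \<in> received (st t k)"
  shows "\<exists>T S. bcrb_dl ev T k M (combine C c S) \<and> enough_shares C thr c S \<and>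
    (M, Cipher c) \<in> received (st T k)"
proof -
  obtain j sn where jsn: "M = (j, sn)" by fastforce
  obtain T where T: "sn \<le> vec (st T k) j" using eventually_removed[OF k] M(1) jsn by fastforce
  have sn: "1 \<le> sn" using consistentD(5)[OF consistent[OF k] M(1)] jsn by simp
  \<comment> \<open>The entry starts at \<open>0 < sn\<close>, so there is a first time at which it
    reaches \<open>sn\<close>; as it moves by single increments, that step delivers \<open>M\<close>
    and no other message.\<close>
  have "\<exists>T'<T. vec (st T' k) j < sn \<and> sn \<le> vec (st (Suc T') k) j"
    using ex_least_nat_less[of "\<lambda>t. sn \<le> vec (st t k) j" T] T sn init[OF k]
    by (force simp: init_state_def not_le)
  then obtain T' where T': "vec (st T' k) j < sn" "sn \<le> vec (st (Suc T') k) j" by blast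
  then obtain out where ev: "ev T' = (k, Deliver M out)"
    using step_vec by (cases rule: step_or_same[OF k, of T']) (fastforce simp: jsn)+
  then obtain p where p: "(M, p) \<in> received (st T' k)" "deliverable C thr (st T' k) M p"
    "out = (case p of Cipher c \<Rightarrow> Some (combine C c (valid_shares C (st T' k) M c)) | _ \<Rightarrow> None)"
    by (rule DeliverE[OF k])
  have "p = Cipher c" using received_unique[OF k p(1) M(2)] .
  with p ev have "bcrb_dl ev T' k M (combine C c (valid_shares C (st T' k) M c))"
    "enough_shares C thr c (valid_shares C (st T' k) M c)" "(M, Cipher c) \<in> received (st T' k)"
    using deliverable_enough_shares[OF k] by (simp_all add: bcrb_dl_def)
  then show ?thesis by blast
qed

lemma combine_encrypt:
  "enough_shares C thr (encrypt C (pub_key C) m r) S \<Longrightarrow>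
    combine C (encrypt C (pub_key C) m r) S = m"
  using enc unfolding threshold_encryption_def Let_def by blast

lemma combine_unique:
  "enough_shares C thr c S \<Longrightarrow> enough_shares C thr c S' \<Longrightarrow> combine C c S = combine C c S'"
  using enc unfolding threshold_encryption_def by blast

section \<open>The three BCRB properties\<close>

lemma Bcrb_BroadcastD:
  assumes "i \<in> Corr" "ev t = (i, Bcrb_Broadcast sn m c)"
  shows "local_sn (st (Suc t) i) = sn \<and> 1 \<le> sn \<and> (\<exists>r. c = encrypt C (pub_key C) m r)"
  using step_ev[OF assms] by (auto elim: step.cases)

lemma bcrb_validity: "rb_validity Corr (bcrb_bc ev) (bcrb_dl ev)"
  unfolding rb_validity_def
proof (intro allI ballI impI)
  fix t sn m i k assume i: "i \<in> Corr" and k: "k \<in> Corr" and "bcrb_bc ev t (i, sn) m"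
  then obtain c where ev: "ev t = (i, Bcrb_Broadcast sn m c)" by (auto simp: bcrb_bc_def)
  obtain r where r: "local_sn (st (Suc t) i) = sn" "1 \<le> sn" "c = encrypt C (pub_key C) m r"
    using Bcrb_BroadcastD[OF i ev] by blast
  have "brb_bc ev t (i, sn) (Cipher c)" using ev by (simp add: brb_bc_def)
  then obtain t0 where t0: "t \<le> t0" "brb_dl ev t0 k (i, sn) (Cipher c)"
    by (rule brb_validityE[OF i k])
  obtain T where "(i, sn) \<in> processed (st T k)"
    using broadcasts_processed[OF i k, of "Suc t"] r by fastforce
  then have "(i, sn) \<in> processed (st (max T (Suc t0)) k)"
    using processed_mono[OF k, of T "max T (Suc t0)"] by auto
  moreover have "((i, sn), Cipher c) \<in> received (st (max T (Suc t0)) k)"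
    using t0 k by (auto simp: received_iff less_max_iff_disj)
  ultimately obtain T' S where T': "bcrb_dl ev T' k (i, sn) (combine C c S)"
    "enough_shares C thr c S" "((i, sn), Cipher c) \<in> received (st T' k)"
    using processed_bcrb_dl[OF k] by blast
  \<comment> \<open>The BCRB delivery comes after some BRB delivery of the ciphertext, which by BRB
    Integrity is the one at \<open>t0\<close>, and \<open>t \<le> t0\<close>.\<close>
  obtain t1 where "t1 < T'" "brb_dl ev t1 k (i, sn) (Cipher c)"
    using T'(3) k by (auto simp: received_iff)
  moreover from this have "t1 = t0" using t0(2) integrity k by (auto simp: rb_integrity_def)
  ultimately show "\<exists>t'\<ge>t. bcrb_dl ev t' k (i, sn) m"
    using T' combine_encrypt t0(1) r(3) by (intro exI[of _ T']) auto
qed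

text \<open>The two processes may combine different sets of shares, and a Byzantine sender's
  ciphertext need not come from \<open>encrypt\<close>; \<open>combine_unique\<close> still makes
  the plaintexts equal.\<close>

lemma bcrb_agreement: "rb_agreement Corr (bcrb_dl ev)"
  unfolding rb_agreement_def
proof (intro allI ballI impI)
  fix t M m i k assume i: "i \<in> Corr" and k: "k \<in> Corr" and "bcrb_dl ev t i M m"
  then obtain c S where c: "M \<in> processed (st t i)" "(M, Cipher c) \<in> received (st t i)"
    "enough_shares C thr c S" "m = combine C c S"
    using bcrb_dlE by metis
  obtain T where T: "M \<in> processed (st T k)" using processed_agreement[OF i k] c(1) by blast
  obtain t0 where t0: "brb_dl ev t0 k M (Cipher c)"
    using received_agreement[OF i k c(2)] .
  let ?T = "max T (Suc t0)"
  have "M \<in> processed (st ?T k)" using T processed_mono[OF k, of T ?T] by auto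
  moreover have "(M, Cipher c) \<in> received (st ?T k)"
    using t0 k by (auto simp: received_iff less_max_iff_disj)
  ultimately obtain T' S' where "bcrb_dl ev T' k M (combine C c S')" "enough_shares C thr c S'"
    using processed_bcrb_dl[OF k] by blast
  then show "\<exists>t'. bcrb_dl ev t' k M m" using combine_unique c(3,4) by metis
qed

text \<open>A delivery of \<open>M\<close> raises the entry of its sender to \<open>snd M\<close>,
  while another one would need it to be \<open>snd M - 1\<close>; entries never decrease.\<close>

lemma Deliver_once:
  assumes k: "k \<in> Corr" and "ev t = (k, Deliver M out)" "ev t' = (k, Deliver M out')"
  shows "\<not> t < t'"
proof
  assume "t < t'"
  have "snd M = vec (st (Suc t) k) (fst M)" using step_DeliverD step_ev[OF k assms(2)] by metis
  also have "\<dots> \<le> vec (st t' k) (fst M)" using vec_mono[OF k] \<open>t < t'\<close> by simp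
  also have "\<dots> < snd M" using step_DeliverD[OF step_ev[OF k assms(3)]] by (auto simp: deliverable_iff)
  finally show False by simp
qed

lemma bcrb_integrity: "rb_integrity Corr (bcrb_bc ev) (bcrb_dl ev)"
  unfolding rb_integrity_def
proof (intro conjI ballI allI impI)
  fix k M t m t' m' assume k: "k \<in> Corr" and *: "bcrb_dl ev t k M m \<and> bcrb_dl ev t' k M m'"
  then show "t = t'" using Deliver_once[OF k] unfolding bcrb_dl_def by (meson linorder_neqE_nat)
  with * show "m = m'" by (auto simp: bcrb_dl_def)
next
  fix k j sn t m assume k: "k \<in> Corr" and j: "j \<in> Corr" and "bcrb_dl ev t k (j, sn) m"
  then obtain c S where c: "((j, sn), Cipher c) \<in> received (st t k)"
    "enough_shares C thr c S" "m = combine C c S"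
    using bcrb_dlE by metis
  then obtain t1 where t1: "t1 < t" "brb_dl ev t1 k (j, sn) (Cipher c)"
    using k by (auto simp: received_iff)
  then obtain t0 where t0: "t0 < t1" "brb_bc ev t0 (j, sn) (Cipher c)"
    using integrity k j unfolding rb_integrity_def by blast
  \<comment> \<open>The handler of a correct process broadcasts only ACKs, so this ciphertext stems
    from a \<open>bcrb_broadcast\<close>.\<close>
  have "\<not> (\<exists>M q. ev t0 = (j, Handle M q (Some (sn, Cipher c))))"
    using step_ev[OF j, of t0] by (auto elim: step.cases)
  then obtain m' where ev: "ev t0 = (j, Bcrb_Broadcast sn m' c)"
    using t0(2) by (auto simp: brb_bc_def)
  then have "m = m'" using Bcrb_BroadcastD[OF j ev] combine_encrypt c by auto
  then show "\<exists>t0<t. bcrb_bc ev t0 (j, sn) m"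
    using ev t0(1) t1(1) by (intro exI[of _ t0]) (auto simp: bcrb_bc_def)
qed

end

theorem theoremB5:
  fixes n f :: nat
    and Byz Corr :: "'p::finite set"
    and C :: "('p, 'pk, 'sk, 'm, 'r, 'c, 'sh, 'h) crypto"
    and ev :: "('p, 'm, 'c, 'sh, 'h) trace"
    and st :: "nat \<Rightarrow> 'p \<Rightarrow> ('p, 'c, 'sh, 'h) pstate"
  assumes "card (UNIV :: 'p set) = n" and "n \<ge> 3 * f + 1"
    and "card Byz \<le> f" and "Corr = - Byz"
    and "threshold_encryption C (n - f)"
    and "execution C (n - f) Corr ev st"
    and "fair C (n - f) Corr ev st"
    and "unpredictable C Corr ev"
    and "rb_validity Corr (brb_bc ev) (brb_dl ev)"
    and "rb_agreement Corr (brb_dl ev)"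
    and "rb_integrity Corr (brb_bc ev) (brb_dl ev)"
  shows "rb_validity Corr (bcrb_bc ev) (bcrb_dl ev) \<and>
         rb_agreement Corr (bcrb_dl ev) \<and>
         rb_integrity Corr (bcrb_bc ev) (bcrb_dl ev)"
proof -
  have "n - f \<le> card Corr"
    using assms(1,3,4) by (simp add: Compl_eq_Diff_UNIV card_Diff_subset)
  then interpret protocol_run "n - f" Corr C ev st
    using assms by unfold_locales
  show ?thesis using bcrb_validity bcrb_agreement bcrb_integrity by blast
qed

end
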